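(* Let $\mathcal X$ be a finite-dimensional Euclidean space, let $\kappa:\mathcal X\to\mathbb R\cup\{+\infty\}$ be a gauge, and let $\mathcal C\subseteq\mathcal X$ be a nonempty closed convex set with $0\notin\mathcal C$. Let $$v_p=\inf_x\{\kappa(x)\mid x\in\mathcal C\},\qquad v_g=\inf_y\{\kappa^\circ(y)\mid y\in\mathcal C'\}.$$ Suppose that $\kappa$ is closed, that $\operatorname{ri}\operatorname{dom}\kappa\cap\operatorname{ri}\mathcal C\neq\emptyset$, and that $\operatorname{ri}\operatorname{dom}\kappa^\circ\cap\operatorname{ri}\mathcal C'\neq\emptyset$. Then $v_pv_g=1$ and both values are attained.
   Context: A gauge is a nonnegative, positively homogeneous convex function $\kappa:\mathcal X\to\mathbb R\cup\{+\infty\}$ with $\kappa(0)=0$; $\operatorname{dom}\kappa=\{x\mid\kappa(x)<\infty\}$. It is closed if its epigraph is closed (equivalently, it is lower semicontinuous). Its polar is the gauge $\kappa^\circ(y)=\inf\{\mu>0\mid\langle x,y\rangle\le\mu\kappa(x)\ \forall x\}$ (with $\inf\emptyset=+\infty$). The antipolar of a set $\mathcal C$ is $\mathcal C'=\{y\mid\langle y,x\rangle\ge1\ \forall x\in\mathcal C\}$. $\operatorname{ri}$ denotes relative interior. *)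

theory Defs
  imports "HOL-Analysis.Analysis"
begin

text \<open>Functions into \<open>\<real> \<union> {+\<infinity>}\<close> are modelled with values in \<^typ>\<open>ereal\<close>.  The value \<open>-\<infinity>\<close> is
  excluded for gauges by nonnegativity.  The names \<open>gauge\<close>, \<open>dom\<close> and \<open>epigraph\<close> already denote
  other notions in the libraries.\<close>

definition epi :: "('a::euclidean_space \<Rightarrow> ereal) \<Rightarrow> ('a \<times> real) set" where
  "epi f = {(x, r). f x \<le> ereal r}"

definition effective_domain :: "('a::euclidean_space \<Rightarrow> ereal) \<Rightarrow> 'a set" where
  "effective_domain f = {x. f x < \<infinity>}"

text \<open>Convexity of an extended-valued function is convexity of its epigraph.\<close>

definition gauge_function :: "('a::euclidean_space \<Rightarrow> ereal) \<Rightarrow> bool" where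
  "gauge_function \<kappa> \<longleftrightarrow>
     (\<forall>x. 0 \<le> \<kappa> x) \<and>
     (\<forall>x t. 0 < t \<longrightarrow> \<kappa> (t *\<^sub>R x) = ereal t * \<kappa> x) \<and>
     convex (epi \<kappa>) \<and>
     \<kappa> 0 = 0"

definition closed_function :: "('a::euclidean_space \<Rightarrow> ereal) \<Rightarrow> bool" where
  "closed_function f \<longleftrightarrow> closed (epi f)"

text \<open>In \<^typ>\<open>ereal\<close> the infimum of the empty set is \<open>+\<infinity>\<close>, as the polar requires.\<close>

definition polar_gauge :: "('a::euclidean_space \<Rightarrow> ereal) \<Rightarrow> 'a \<Rightarrow> ereal" where
  "polar_gauge \<kappa> y = Inf {ereal \<mu> | \<mu>. 0 < \<mu> \<and> (\<forall>x. ereal (x \<bullet> y) \<le> ereal \<mu> * \<kappa> x)}"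

definition antipolar :: "'a::euclidean_space set \<Rightarrow> 'a set" where
  "antipolar C = {y. \<forall>x\<in>C. 1 \<le> y \<bullet> x}"

end

theory Submission
  imports Defs
begin

text \<open>Separating the epigraph of \<open>\<kappa>\<close>, translated by \<open>-C\<close>, properly from the point \<open>(0, v_p)\<close>
  yields a vector \<open>y\<close> below \<open>\<kappa>\<close> whose values on \<open>C\<close> are at least \<open>v_p\<close>; the relative interior
  condition keeps the hyperplane from being vertical.  Then \<open>y / v_p\<close> lies in the antipolar and attains \<open>1 / v_p\<close>,
  which is a lower bound for \<open>v_g\<close> because \<open>1 \<le> x \<bullet> y \<le> \<kappa> x * \<kappa>\<degree> y\<close>.
  Since \<open>\<kappa>\<close> is closed, it is dominated by its bipolar, so
  the same argument for \<open>\<kappa>\<degree>\<close> and the antipolar gives a minimiser of \<open>\<kappa>\<close> over the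
  double antipolar, which consists of the vectors \<open>t x\<close> with \<open>t \<ge> 1\<close> and \<open>x \<in> C\<close>; dividing by
  \<open>t\<close> does not increase \<open>\<kappa>\<close>.\<close>

section \<open>Elementary properties of gauges and their effective domains\<close>

lemma gauge_function_nonneg: "gauge_function \<kappa> \<Longrightarrow> 0 \<le> \<kappa> x"
  by (simp add: gauge_function_def)

lemma gauge_function_zero: "gauge_function \<kappa> \<Longrightarrow> \<kappa> 0 = 0"
  by (simp add: gauge_function_def)

lemma gauge_function_scaleR_le:
  assumes "gauge_function \<kappa>" "0 < t" "\<kappa> x \<le> ereal r"
  shows "\<kappa> (t *\<^sub>R x) \<le> ereal (t * r)"
proof -
  have "ereal t * \<kappa> x \<le> ereal t * ereal r"
    using assms by (intro ereal_mult_left_mono) auto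
  then show ?thesis using assms by (simp add: gauge_function_def)
qed

lemma gauge_function_le_real_nonneg:
  assumes "gauge_function \<kappa>" "\<kappa> x \<le> ereal r"
  shows "0 \<le> r"
  using gauge_function_nonneg[OF assms(1), of x] assms(2) by (cases "\<kappa> x") auto

lemma gauge_function_finiteE:
  assumes "gauge_function \<kappa>" "\<kappa> x < \<infinity>"
  obtains r where "\<kappa> x = ereal r" "0 \<le> r"
  using gauge_function_nonneg[OF assms(1), of x] assms(2) by (cases "\<kappa> x") auto

lemma effective_domain_eq_fst_epi:
  assumes "gauge_function \<kappa>"
  shows "effective_domain \<kappa> = fst ` epi \<kappa>"
proof (intro equalityI subsetI)
  fix x assume "x \<in> effective_domain \<kappa>"
  then obtain r where "\<kappa> x = ereal r"
    using gauge_function_finiteE[OF assms] unfolding effective_domain_def by blast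
  then have "(x, r) \<in> epi \<kappa>" by (simp add: epi_def)
  then show "x \<in> fst ` epi \<kappa>" by force
next
  fix x assume "x \<in> fst ` epi \<kappa>"
  then show "x \<in> effective_domain \<kappa>" by (auto simp: epi_def effective_domain_def)
qed

lemma convex_effective_domain:
  assumes "gauge_function \<kappa>"
  shows "convex (effective_domain \<kappa>)"
  unfolding effective_domain_eq_fst_epi[OF assms]
  using assms by (intro convex_linear_image linear_fst) (simp add: gauge_function_def)

section \<open>The polar of a gauge\<close>

text \<open>The infimum defining the polar ranges over positive factors and need not be attained
  there; the inequalities nevertheless survive the limit, so sublevel sets are cut out by
  inequalities linear in \<open>y\<close>. Testing against real bounds \<open>r\<close> leaves out
  the points where \<kappa> is infinite. For \<open>s = 0\<close> this matters: in
  \<open>ereal\<close> zero times infinity is zero, and those points would impose a false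
  constraint.\<close>

lemma polar_gauge_le_iff:
  assumes g: "gauge_function \<kappa>"
  shows "polar_gauge \<kappa> y \<le> ereal s \<longleftrightarrow> 0 \<le> s \<and> (\<forall>u r. \<kappa> u \<le> ereal r \<longrightarrow> u \<bullet> y \<le> s * r)"
    (is "?L \<longleftrightarrow> ?R")
proof
  assume L: ?L
  have *: "\<exists>m. 0 < m \<and> m < t \<and> (\<forall>u. ereal (u \<bullet> y) \<le> ereal m * \<kappa> u)" if "s < t" for t
  proof -
    have "polar_gauge \<kappa> y < ereal t" using L that by (meson ereal_less_eq(3) le_less_trans less_ereal.simps(1))
    then show ?thesis unfolding polar_gauge_def Inf_less_iff by auto
  qed
  have "0 \<le> s"
  proof (rule ccontr)
    assume "\<not> 0 \<le> s" then show False using *[of 0] by auto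
  qed
  moreover have "u \<bullet> y \<le> s * r" if "\<kappa> u \<le> ereal r" for u r
  proof -
    have r: "0 \<le> r" by (rule gauge_function_le_real_nonneg[OF g that])
    \<comment> \<open>Admissible factors are known to exist only below each \<open>t > s\<close>;
      the bound for \<open>s\<close> itself follows as \<open>t\<close> decreases to
      \<open>s\<close>.\<close>
    have "u \<bullet> y \<le> t * r" if t: "s < t" for t
    proof -
      obtain m where m: "0 < m" "m < t" "ereal (u \<bullet> y) \<le> ereal m * \<kappa> u" using *[OF t] by blast
      have "ereal m * \<kappa> u \<le> ereal m * ereal r"
        using m \<open>\<kappa> u \<le> ereal r\<close> by (intro ereal_mult_left_mono) auto
      then have "ereal (u \<bullet> y) \<le> ereal (m * r)" using m(3) order_trans by fastforce
      then have "u \<bullet> y \<le> m * r" by simp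
      also have "\<dots> \<le> t * r" using m r by (intro mult_right_mono) auto
      finally show ?thesis .
    qed
    then have ev: "eventually (\<lambda>t. u \<bullet> y \<le> t * r) (at_right s)"
      by (rule eventually_mono[OF eventually_at_right_less])
    have "((\<lambda>t. t * r) \<longlongrightarrow> s * r) (at_right s)" by (intro tendsto_intros)
    then show ?thesis using ev by (intro tendsto_lowerbound[where F = "at_right s"]) auto
  qed
  ultimately show ?R by blast
next
  assume R: ?R
  \<comment> \<open>Any \<open>t > s\<close> is positive, hence admissible: where \<kappa> is
    infinite the product with \<open>t\<close> is infinite as well, even if
    \<open>s = 0\<close>.\<close>
  have "polar_gauge \<kappa> y \<le> ereal t" if t: "s < t" for t
  proof -
    have "ereal (u \<bullet> y) \<le> ereal t * \<kappa> u" for u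
    proof (cases "\<kappa> u < \<infinity>")
      case True
      then obtain r where r: "\<kappa> u = ereal r" "0 \<le> r" by (rule gauge_function_finiteE[OF g])
      then have "u \<bullet> y \<le> s * r" using R by simp
      also have "\<dots> \<le> t * r" using t r by (intro mult_right_mono) auto
      finally show ?thesis using r by simp
    next
      case False
      then show ?thesis using t R by simp
    qed
    then show ?thesis unfolding polar_gauge_def using t R by (intro Inf_lower) auto
  qed
  then have "polar_gauge \<kappa> y \<le> ereal s + ereal e" if "0 < e" for e
    using that by simp
  then show ?L by (blast intro: ereal_le_epsilon2)
qed

lemma gauge_function_polar_gauge:
  assumes g: "gauge_function \<kappa>"
  shows "gauge_function (polar_gauge \<kappa>)"
proof -
  have nn: "0 \<le> polar_gauge \<kappa> y" for y
    unfolding polar_gauge_def by (rule Inf_greatest) auto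
  have sc: "polar_gauge \<kappa> (t *\<^sub>R y) \<le> ereal t * polar_gauge \<kappa> y" if t: "0 < t" for t y
  proof (cases "polar_gauge \<kappa> y")
    case (real s)
    then have "0 \<le> s \<and> (\<forall>u r. \<kappa> u \<le> ereal r \<longrightarrow> u \<bullet> y \<le> s * r)"
      using polar_gauge_le_iff[OF g, of y s] by simp
    then have "polar_gauge \<kappa> (t *\<^sub>R y) \<le> ereal (t * s)"
      using t unfolding polar_gauge_le_iff[OF g] by (simp add: mult.assoc)
    then show ?thesis using real by simp
  qed (use t nn[of y] in auto)
  \<comment> \<open>The reverse inequality is \<open>sc\<close> with factor \<open>inverse t\<close>
    at the scaled point.\<close>
  have eq: "polar_gauge \<kappa> (t *\<^sub>R y) = ereal t * polar_gauge \<kappa> y" if t: "0 < t" for t y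
  proof (rule antisym[OF sc[OF t]])
    have "polar_gauge \<kappa> y \<le> ereal (inverse t) * polar_gauge \<kappa> (t *\<^sub>R y)"
      using sc[of "inverse t" "t *\<^sub>R y"] t by simp
    then have "ereal t * polar_gauge \<kappa> y \<le> ereal t * (ereal (inverse t) * polar_gauge \<kappa> (t *\<^sub>R y))"
      using t by (intro ereal_mult_left_mono) auto
    also have "\<dots> = (ereal t * ereal (inverse t)) * polar_gauge \<kappa> (t *\<^sub>R y)"
      by (simp only: mult.assoc)
    also have "\<dots> = polar_gauge \<kappa> (t *\<^sub>R y)" using t by (simp flip: one_ereal_def)
    finally show "ereal t * polar_gauge \<kappa> y \<le> polar_gauge \<kappa> (t *\<^sub>R y)" .
  qed
  \<comment> \<open>By \<open>polar_gauge_le_iff\<close> this epigraph is an intersection of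
    half-spaces in the pair of point and height.\<close>
  have "convex (epi (polar_gauge \<kappa>))"
  proof (rule convexI)
    fix p q :: "'a \<times> real" and a b :: real
    assume p: "p \<in> epi (polar_gauge \<kappa>)" and q: "q \<in> epi (polar_gauge \<kappa>)"
      and ab: "0 \<le> a" "0 \<le> b" "a + b = 1"
    obtain y r z s where [simp]: "p = (y, r)" "q = (z, s)" by (metis surj_pair)
    have y: "0 \<le> r" "\<And>u t. \<kappa> u \<le> ereal t \<Longrightarrow> u \<bullet> y \<le> r * t"
      and z: "0 \<le> s" "\<And>u t. \<kappa> u \<le> ereal t \<Longrightarrow> u \<bullet> z \<le> s * t"
      using p q by (auto simp: epi_def polar_gauge_le_iff[OF g])
    have "u \<bullet> (a *\<^sub>R y + b *\<^sub>R z) \<le> (a * r + b * s) * t" if "\<kappa> u \<le> ereal t" for u t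
    proof -
      have "a * (u \<bullet> y) + b * (u \<bullet> z) \<le> a * (r * t) + b * (s * t)"
        using ab y(2)[OF that] z(2)[OF that] by (intro add_mono mult_left_mono)
      then show ?thesis by (simp add: inner_simps algebra_simps)
    qed
    then show "a *\<^sub>R p + b *\<^sub>R q \<in> epi (polar_gauge \<kappa>)"
      using ab y(1) z(1) by (simp add: epi_def polar_gauge_le_iff[OF g])
  qed
  moreover have "polar_gauge \<kappa> 0 = 0"
    using nn[of 0] polar_gauge_le_iff[OF g, of 0 0] by (simp add: antisym flip: zero_ereal_def)
  ultimately show ?thesis using nn eq by (simp add: gauge_function_def)
qed

text \<open>By \<open>polar_gauge_le_iff\<close> the last hypothesis bounds the bipolar of \<kappa>
  at \<open>x\<close> by 1. If \<kappa> exceeded 1 there, the closed convex set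
  \<open>epi \<kappa>\<close> would be strictly separated from \<open>(x, 1)\<close>. As it is a
  cone, the functional \<open>(a, b)\<close> is nonnegative on it and negative at
  \<open>(x, 1)\<close>; then \<open>- a\<close> has polar value at most \<open>b\<close> although
  its inner product with \<open>x\<close> exceeds \<open>b\<close>.\<close>

lemma le_one_if_inner_le_polar_gauge:
  assumes g: "gauge_function \<kappa>" and cl: "closed_function \<kappa>"
    and x: "\<And>y r. polar_gauge \<kappa> y \<le> ereal r \<Longrightarrow> y \<bullet> x \<le> r"
  shows "\<kappa> x \<le> 1"
proof (rule ccontr)
  assume "\<not> \<kappa> x \<le> 1"
  then have "(x, 1) \<notin> epi \<kappa>" by (simp add: epi_def flip: one_ereal_def)
  moreover have "convex (epi \<kappa>)" "closed (epi \<kappa>)"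
    using g cl by (auto simp: gauge_function_def closed_function_def)
  ultimately obtain p \<gamma> where *: "p \<bullet> (x, 1) < \<gamma>" "\<forall>q\<in>epi \<kappa>. \<gamma> < p \<bullet> q"
    using separating_hyperplane_closed_point by blast
  obtain a b where [simp]: "p = (a, b)" by (metis surj_pair)
  have sep: "\<gamma> < a \<bullet> u + b * r" if "\<kappa> u \<le> ereal r" for u r
    using *(2) that by (auto simp: epi_def)
  have "\<gamma> < 0" using sep[of 0 0] gauge_function_zero[OF g] by simp
  then have neg: "a \<bullet> x + b < 0" using *(1) by simp
  \<comment> \<open>If the functional were negative at a point of the cone, rescaling that point
    would give the value \<gamma> exactly, against the strict bound \<open>sep\<close>.\<close>
  have nonneg: "0 \<le> a \<bullet> u + b * r" if ur: "\<kappa> u \<le> ereal r" for u r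
  proof (rule ccontr)
    let ?w = "a \<bullet> u + b * r" and ?t = "\<gamma> / (a \<bullet> u + b * r)"
    assume w: "\<not> 0 \<le> ?w"
    then have t: "0 < ?t" using \<open>\<gamma> < 0\<close> by (simp add: divide_neg_neg)
    have "\<gamma> < ?t * ?w"
      using sep[OF gauge_function_scaleR_le[OF g t ur]]
      by (simp only: inner_scaleR_right distrib_left mult.left_commute)
    then show False using w by simp
  qed
  have "0 \<le> b" using nonneg[of 0 1] gauge_function_zero[OF g] by simp
  have "u \<bullet> (- a) \<le> b * r" if "\<kappa> u \<le> ereal r" for u r
    using nonneg[OF that] by (simp add: inner_commute)
  then have "polar_gauge \<kappa> (- a) \<le> ereal b"
    using \<open>0 \<le> b\<close> polar_gauge_le_iff[OF g] by blast
  then have "(- a) \<bullet> x \<le> b" by (rule x)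
  then show False using neg by simp
qed

section \<open>Supporting functionals of the minimisation problem\<close>

text \<open>The first conclusion means that the polar of \<kappa> at \<open>y\<close> is at most 1;
  for \<open>v > 0\<close> the second puts \<open>y / v\<close> into the antipolar. The lemma thus
  yields a dual solution up to scaling, and it serves both for \<kappa> with \<open>C\<close> and
  for the polar with the antipolar.\<close>

lemma gauge_duality_support:
  fixes \<kappa> :: "'a::euclidean_space \<Rightarrow> ereal"
  assumes g: "gauge_function \<kappa>" and C: "convex C"
    and ri: "rel_interior (effective_domain \<kappa>) \<inter> rel_interior C \<noteq> {}"
    and v: "(INF x\<in>C. \<kappa> x) = ereal v"
  obtains y where "\<And>u r. \<kappa> u \<le> ereal r \<Longrightarrow> u \<bullet> y \<le> r" "\<And>c. c \<in> C \<Longrightarrow> v \<le> c \<bullet> y"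
proof -
  let ?D = "effective_domain \<kappa>"
  \<comment> \<open>The fibre of \<open>E\<close> over 0 consists of the upper bounds of the values
    of \<kappa> on \<open>C\<close>, so its heights have infimum \<open>v\<close>.\<close>
  define E where "E = (\<Union>p\<in>epi \<kappa>. \<Union>q\<in>C \<times> {0::real}. {p - q})"
  have E_iff: "(z, r) \<in> E \<longleftrightarrow> (\<exists>u c. c \<in> C \<and> z = u - c \<and> \<kappa> u \<le> ereal r)" for z r
    unfolding E_def by (force simp: epi_def)
  have E: "convex E"
    unfolding E_def using g C by (intro convex_differences convex_Times) (auto simp: gauge_function_def)
  obtain u0 where u0: "u0 \<in> rel_interior ?D" "u0 \<in> rel_interior C" using ri by blast
  then have u0': "u0 \<in> ?D" "u0 \<in> C" using rel_interior_subset by blast+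
  have above: "(0, v + e) \<in> E" if "0 < e" for e
  proof -
    have "(INF x\<in>C. \<kappa> x) < ereal (v + e)" using that v by simp
    then obtain c where "c \<in> C" "\<kappa> c < ereal (v + e)" unfolding Inf_less_iff by blast
    then show ?thesis unfolding E_iff by (intro exI[of _ c]) auto
  qed
  have below: "(0, r) \<notin> E" if "r < v" for r
  proof
    assume "(0, r) \<in> E"
    then obtain c where "c \<in> C" "\<kappa> c \<le> ereal r" unfolding E_iff by auto
    then have "(INF x\<in>C. \<kappa> x) \<le> ereal r" by (meson INF_lower order_trans)
    then show False using v that by simp
  qed
  have "(0, v) \<in> closure E"
    unfolding closure_approachable
  proof (intro allI impI)
    fix e :: real assume "0 < e"
    then show "\<exists>p\<in>E. dist p (0, v) < e"
      using above[of "e / 2"] by (intro bexI[of _ "(0, v + e / 2)"]) (auto simp: dist_Pair_Pair dist_real_def)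
  qed
  \<comment> \<open>Otherwise the segment from \<open>(0, v + 1)\<close> could be prolonged inside
    \<open>E\<close> past \<open>(0, v)\<close>, reaching a height below \<open>v\<close>.\<close>
  moreover have "(0, v) \<notin> rel_interior E"
  proof
    assume "(0, v) \<in> rel_interior E"
    then obtain e :: real where e: "1 < e"
      "(1 - e) *\<^sub>R (0::'a, v + 1) + e *\<^sub>R (0, v) \<in> E"
      using convex_rel_interior_iff[OF E] above[of 1] by force
    then have "(0, v + (1 - e)) \<in> E" by (simp add: algebra_simps)
    then show False using below[of "v + (1 - e)"] e(1) by simp
  qed
  ultimately obtain p where p: "\<And>q. q \<in> closure E \<Longrightarrow> p \<bullet> (0, v) \<le> p \<bullet> q"
    "\<And>q. q \<in> rel_interior E \<Longrightarrow> p \<bullet> (0, v) < p \<bullet> q"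
    using supporting_hyperplane_relative_frontier[OF E] by metis
  obtain a b where [simp]: "p = (a, b)" by (metis surj_pair)
  have sep: "b * v \<le> a \<bullet> u - a \<bullet> c + b * r" if "c \<in> C" "\<kappa> u \<le> ereal r" for u c r
  proof -
    have "(u - c, r) \<in> closure E" using that E_iff closure_subset by blast
    from p(1)[OF this] show ?thesis by (simp add: inner_diff_right)
  qed
  have "0 \<le> b" using p(1)[of "(0, v + 1)"] above[of 1] closure_subset by (force simp: algebra_simps)
  \<comment> \<open>A vertical hyperplane would separate the domain from \<open>C\<close>. Segments
    ending at \<open>u0\<close> can be prolonged inside either set because \<open>u0\<close> is in
    both relative interiors. This reverses the inequality, so \<open>a\<close> would vanish on all
    differences \<open>u - c\<close>, contradicting strictness on the relative interior of
    \<open>E\<close>.\<close>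
  have "b \<noteq> 0"
  proof
    assume [simp]: "b = 0"
    have le: "a \<bullet> c \<le> a \<bullet> u" if "u \<in> ?D" "c \<in> C" for u c
    proof -
      obtain r where "\<kappa> u = ereal r"
        using \<open>u \<in> ?D\<close> gauge_function_finiteE[OF g, of u] unfolding effective_domain_def by blast
      then show ?thesis using sep[OF \<open>c \<in> C\<close>, of u r] by simp
    qed
    have const_D: "a \<bullet> u \<le> a \<bullet> u0" if u: "u \<in> ?D" for u
    proof -
      obtain e where e: "1 < e" "(1 - e) *\<^sub>R u + e *\<^sub>R u0 \<in> ?D"
        using convex_rel_interior_if2[OF convex_effective_domain[OF g] u0(1)] hull_inc[OF u] by blast
      have "(e - 1) * (a \<bullet> u) \<le> (e - 1) * (a \<bullet> u0)"
        using le[OF e(2) u0'(2)] by (simp add: inner_simps algebra_simps)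
      then show ?thesis using e(1) by simp
    qed
    have const_C: "a \<bullet> u0 \<le> a \<bullet> c" if c: "c \<in> C" for c
    proof -
      obtain e where e: "1 < e" "(1 - e) *\<^sub>R c + e *\<^sub>R u0 \<in> C"
        using convex_rel_interior_if2[OF C u0(2)] hull_inc[OF c] by blast
      have "(e - 1) * (a \<bullet> u0) \<le> (e - 1) * (a \<bullet> c)"
        using le[OF u0'(1) e(2)] by (simp add: inner_simps algebra_simps)
      then show ?thesis using e(1) by simp
    qed
    have "rel_interior E \<noteq> {}" using above[of 1] rel_interior_eq_empty[OF E] by auto
    then obtain z r where zr: "(z, r) \<in> rel_interior E" by auto
    then obtain u c where "c \<in> C" "z = u - c" "\<kappa> u \<le> ereal r"
      using E_iff rel_interior_subset by blast
    moreover from this have "u \<in> ?D" by (auto simp: effective_domain_def)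
    ultimately show False using p(2)[OF zr] const_D[of u] const_C[of c] by (simp add: inner_diff_right)
  qed
  with \<open>0 \<le> b\<close> have b: "0 < b" by simp
  define y where "y = - (inverse b *\<^sub>R a)"
  have a: "a = - (b *\<^sub>R y)" using b by (simp add: y_def)
  \<comment> \<open>Only \<open>c\<close> occurs on the left and only \<open>(u, r)\<close> on the
    right. Taking \<open>(0, 0)\<close> on the right gives the bound on \<open>C\<close>; fixing
    \<open>u0\<close> on the left and scaling \<open>(u, r)\<close> gives the bound by
    \<kappa>.\<close>
  have sep': "v - c \<bullet> y \<le> r - u \<bullet> y" if "c \<in> C" "\<kappa> u \<le> ereal r" for u c r
  proof -
    have "b * (v - c \<bullet> y) \<le> b * (r - u \<bullet> y)"
      using sep[OF that] by (simp add: a algebra_simps inner_commute)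
    then show ?thesis using b by simp
  qed
  show thesis
  proof
    fix c assume "c \<in> C"
    then show "v \<le> c \<bullet> y" using sep'[of c 0 0] gauge_function_zero[OF g] by simp
  next
    fix u r assume ur: "\<kappa> u \<le> ereal r"
    show "u \<bullet> y \<le> r"
    proof (rule ccontr)
      let ?w = "u \<bullet> y - r" and ?k = "v - u0 \<bullet> y"
      assume "\<not> u \<bullet> y \<le> r"
      then have w: "0 < ?w" by simp
      \<comment> \<open>Large enough that \<open>- (t * ?w)\<close>, the right side of
        \<open>sep'\<close> after scaling by \<open>t\<close>, drops below its fixed left side
        \<open>?k\<close>.\<close>
      define t where "t = (\<bar>?k\<bar> + 1) / ?w"
      have t: "0 < t" using w by (simp add: t_def)
      have "?k \<le> - (t * ?w)"
        using sep'[OF u0'(2) gauge_function_scaleR_le[OF g t ur]] by (simp add: algebra_simps)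
      also have "t * ?w = \<bar>?k\<bar> + 1" using w by (simp add: t_def)
      finally show False by simp
    qed
  qed
qed

section \<open>Antipolar sets and the double antipolar\<close>

lemma convex_antipolar: "convex (antipolar C)"
proof (rule convexI)
  fix y z and a b :: real
  assume *: "y \<in> antipolar C" "z \<in> antipolar C" "0 \<le> a" "0 \<le> b" "a + b = 1"
  have "1 \<le> (a *\<^sub>R y + b *\<^sub>R z) \<bullet> x" if "x \<in> C" for x
  proof -
    have "a * 1 + b * 1 \<le> a * (y \<bullet> x) + b * (z \<bullet> x)"
      using * that by (intro add_mono mult_left_mono) (auto simp: antipolar_def)
    then show ?thesis using * by (simp add: inner_simps)
  qed
  then show "a *\<^sub>R y + b *\<^sub>R z \<in> antipolar C" by (simp add: antipolar_def)
qed

lemma convex_scaleR_ge_one: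
  fixes C :: "'a::real_vector set"
  assumes C: "convex C"
  shows "convex {t *\<^sub>R c |t c. 1 \<le> t \<and> c \<in> C}"
proof (rule convexI)
  fix p q and a b :: real
  assume p: "p \<in> {t *\<^sub>R c |t c. 1 \<le> t \<and> c \<in> C}" and q: "q \<in> {t *\<^sub>R c |t c. 1 \<le> t \<and> c \<in> C}"
    and ab: "0 \<le> a" "0 \<le> b" "a + b = 1"
  obtain s c where s: "p = s *\<^sub>R c" "1 \<le> s" "c \<in> C" using p by blast
  obtain t d where t: "q = t *\<^sub>R d" "1 \<le> t" "d \<in> C" using q by blast
  \<comment> \<open>The combination is \<open>k\<close> times a convex combination of
    \<open>c\<close> and \<open>d\<close>, whose weights are \<open>a * s / k\<close> and
    \<open>b * t / k\<close>.\<close>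
  define k where "k = a * s + b * t"
  have "a * 1 + b * 1 \<le> k"
    unfolding k_def using ab s t by (intro add_mono mult_left_mono) auto
  then have k: "1 \<le> k" using ab by simp
  have "(a * s / k) *\<^sub>R c + (b * t / k) *\<^sub>R d \<in> C"
    using ab s t k by (intro convexD[OF C]) (auto simp: k_def simp flip: add_divide_distrib)
  moreover have "a *\<^sub>R p + b *\<^sub>R q = k *\<^sub>R ((a * s / k) *\<^sub>R c + (b * t / k) *\<^sub>R d)"
    using k s t by (simp add: scaleR_add_right)
  ultimately show "a *\<^sub>R p + b *\<^sub>R q \<in> {t *\<^sub>R c |t c. 1 \<le> t \<and> c \<in> C}" using k by blast
qed

text \<open>The factors \<open>t\<close> may be unbounded, but their inverses lie in the compact
  interval from 0 to 1. Along a subsequence these converge to some \<open>s0\<close>, whence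
  \<open>s0\<close> times the limit lies in \<open>C\<close>; since 0 is not in \<open>C\<close>,
  \<open>s0\<close> is nonzero and can be inverted.\<close>

lemma closed_scaleR_ge_one:
  fixes C :: "'a::euclidean_space set"
  assumes C: "closed C" "0 \<notin> C"
  shows "closed {t *\<^sub>R c |t c. 1 \<le> t \<and> c \<in> C}"
proof -
  have "l \<in> {t *\<^sub>R c |t c. 1 \<le> t \<and> c \<in> C}"
    if f: "\<And>n. f n \<in> {t *\<^sub>R c |t c. 1 \<le> t \<and> c \<in> C}" and l: "f \<longlonglongrightarrow> l" for f l
  proof -
    have "\<forall>n. \<exists>s c. f n = inverse s *\<^sub>R c \<and> s \<in> {0..1} \<and> s \<noteq> 0 \<and> c \<in> C"
    proof
      fix n
      obtain t c where "f n = t *\<^sub>R c" "1 \<le> t" "c \<in> C" using f[of n] by blast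
      then show "\<exists>s c. f n = inverse s *\<^sub>R c \<and> s \<in> {0..1} \<and> s \<noteq> 0 \<and> c \<in> C"
        by (intro exI[of _ "inverse t"] exI[of _ c]) (auto simp: inverse_le_1_iff)
    qed
    then obtain s c where sc: "\<And>n. f n = inverse (s n) *\<^sub>R c n" "\<And>n. s n \<in> {0..1::real}"
      "\<And>n. s n \<noteq> 0" "\<And>n. c n \<in> C" by metis
    have "compact {0..1::real}" by simp
    then obtain s0 \<phi> where s0: "s0 \<in> {0..1}" "strict_mono \<phi>" "(s \<circ> \<phi>) \<longlonglongrightarrow> s0"
      using sc(2) unfolding compact_def by metis
    have c: "c n = s n *\<^sub>R f n" for n using sc(1)[of n] sc(3)[of n] by simp
    have "(\<lambda>n. (s \<circ> \<phi>) n *\<^sub>R (f \<circ> \<phi>) n) \<longlonglongrightarrow> s0 *\<^sub>R l"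
      by (intro tendsto_scaleR s0(3) LIMSEQ_subseq_LIMSEQ[OF l s0(2)])
    then have "(c \<circ> \<phi>) \<longlonglongrightarrow> s0 *\<^sub>R l" by (simp add: c comp_def)
    then have mem: "s0 *\<^sub>R l \<in> C"
      using closed_sequentially[OF C(1)] sc(4) by (metis comp_apply)
    with C(2) have "s0 \<noteq> 0" by auto
    with s0(1) have "l = inverse s0 *\<^sub>R (s0 *\<^sub>R l)" "1 \<le> inverse s0"
      by (auto simp: one_le_inverse_iff)
    with mem show ?thesis by blast
  qed
  then show ?thesis by (auto simp: closed_sequential_limits)
qed

text \<open>A point \<open>z\<close> outside the closed convex set on the right is strictly
  separated from it by some \<open>a\<close> with level \<beta>. For positive \<beta>, the vector
  \<open>a\<close> divided by \<beta> is in the antipolar and has inner product below 1 with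
  \<open>z\<close>. Otherwise \<open>a\<close> is nonnegative on \<open>C\<close> and negative at
  \<open>z\<close>, so adding a multiple of \<open>a\<close> to any element of the antipolar stays
  there and lowers the product with \<open>z\<close> below 1.\<close>

lemma antipolar_antipolar_subset:
  fixes C :: "'a::euclidean_space set"
  assumes C: "convex C" "closed C" "0 \<notin> C" and ne: "antipolar C \<noteq> {}"
  shows "antipolar (antipolar C) \<subseteq> {t *\<^sub>R c |t c. 1 \<le> t \<and> c \<in> C}" 
proof (rule subsetI, rule ccontr)
  define S where "S = {t *\<^sub>R c |t c. 1 \<le> t \<and> c \<in> C}"
  fix z assume z: "z \<in> antipolar (antipolar C)" and "z \<notin> {t *\<^sub>R c |t c. 1 \<le> t \<and> c \<in> C}"
  then have "z \<notin> S" by (simp only: S_def not_False_eq_True)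
  moreover have "convex S" "closed S"
    unfolding S_def by (rule convex_scaleR_ge_one[OF C(1)], rule closed_scaleR_ge_one[OF C(2,3)])
  ultimately
  obtain a \<beta> where a: "a \<bullet> z < \<beta>" "\<And>x. x \<in> S \<Longrightarrow> \<beta> < a \<bullet> x"
    using separating_hyperplane_closed_point by metis
  have ge: "\<beta> < t * (a \<bullet> c)" if "1 \<le> t" "c \<in> C" for t c
  proof -
    have "t *\<^sub>R c \<in> S" unfolding S_def using that by blast
    from a(2)[OF this] show ?thesis by simp
  qed
  obtain y0 where y0: "y0 \<in> antipolar C" using ne by blast
  have z1: "1 \<le> z \<bullet> y" if "y \<in> antipolar C" for y
    using z that by (simp add: antipolar_def)
  show False
  proof (cases "0 < \<beta>")
    case True
    have "inverse \<beta> *\<^sub>R a \<in> antipolar C"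
      using True ge[of 1] by (force simp: antipolar_def field_simps)
    from z1[OF this] have "\<beta> \<le> a \<bullet> z" using True by (simp add: field_simps inner_commute)
    then show False using a(1) by simp
  next
    case False
    have nonneg: "0 \<le> a \<bullet> c" if "c \<in> C" for c
    proof (rule ccontr)
      assume neg: "\<not> 0 \<le> a \<bullet> c"
      \<comment> \<open>The quotient is nonnegative, so this factor is allowed; it sends
        \<open>a \<bullet> c\<close> to \<open>a \<bullet> c + \<beta>\<close>, which is below
        \<beta>.\<close>
      let ?t = "1 + \<beta> / (a \<bullet> c)"
      have "0 \<le> \<beta> / (a \<bullet> c)" using neg False by (simp add: divide_nonpos_nonpos)
      then have "\<beta> < ?t * (a \<bullet> c)" using ge[of ?t c] that by simp
      also have "\<dots> = a \<bullet> c + \<beta>" using neg by (simp add: algebra_simps)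
      finally show False using neg by simp
    qed
    have az: "a \<bullet> z < 0" using a(1) False by simp
    \<comment> \<open>Chosen so that adding \<open>t *\<^sub>R a\<close> to \<open>y0\<close> brings
      the inner product with \<open>z\<close> down to at most 0.\<close>
    define t where "t = \<bar>z \<bullet> y0\<bar> / - (a \<bullet> z)"
    have "0 \<le> t" using az unfolding t_def by (intro divide_nonneg_pos) auto
    then have "1 \<le> (y0 + t *\<^sub>R a) \<bullet> c" if "c \<in> C" for c
      using y0 nonneg[OF that] that
      by (simp add: antipolar_def inner_simps add_increasing2)
    then have "y0 + t *\<^sub>R a \<in> antipolar C" by (simp add: antipolar_def)
    from z1[OF this] have "1 \<le> z \<bullet> y0 + t * (a \<bullet> z)" by (simp add: inner_simps inner_commute)
    also have "t * (a \<bullet> z) = - \<bar>z \<bullet> y0\<bar>" using az by (simp add: t_def field_simps)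
    finally show False by simp
  qed
qed

section \<open>Strong duality and attainment of both values\<close>

theorem corollary5p4:
  fixes \<kappa> :: "'a::euclidean_space \<Rightarrow> ereal" and C :: "'a set" and v_p v_g :: ereal
  assumes "gauge_function \<kappa>"
    and "C \<noteq> {}" and "closed C" and "convex C" and "0 \<notin> C"
    and "v_p = (INF x\<in>C. \<kappa> x)"
    and "v_g = (INF y\<in>antipolar C. polar_gauge \<kappa> y)"
    and "closed_function \<kappa>"
    and "rel_interior (effective_domain \<kappa>) \<inter> rel_interior C \<noteq> {}"
    and "rel_interior (effective_domain (polar_gauge \<kappa>)) \<inter> rel_interior (antipolar C) \<noteq> {}"
  shows "v_p * v_g = 1 \<and> (\<exists>x\<in>C. \<kappa> x = v_p) \<and> (\<exists>y\<in>antipolar C. polar_gauge \<kappa> y = v_g)"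
proof -
  note g = assms(1)
  let ?\<kappa>' = "polar_gauge \<kappa>"
  have g': "gauge_function ?\<kappa>'" by (rule gauge_function_polar_gauge[OF g])
  obtain x1 where "x1 \<in> effective_domain \<kappa>" and x1: "x1 \<in> C"
    using assms(9) rel_interior_subset by blast
  then obtain r1 where r1: "\<kappa> x1 = ereal r1" "0 \<le> r1"
    using gauge_function_finiteE[OF g] by (auto simp: effective_domain_def)
  obtain y1 where "y1 \<in> effective_domain ?\<kappa>'" and y1: "y1 \<in> antipolar C"
    using assms(10) rel_interior_subset by blast
  then obtain s1 where s1: "?\<kappa>' y1 = ereal s1" "0 \<le> s1"
    using gauge_function_finiteE[OF g'] by (auto simp: effective_domain_def)
  have weak: "1 \<le> s * r" if "x \<in> C" "y \<in> antipolar C" "\<kappa> x \<le> ereal r" "?\<kappa>' y \<le> ereal s" for x y r s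
  proof -
    have "1 \<le> x \<bullet> y" using that by (simp add: antipolar_def inner_commute)
    also have "\<dots> \<le> s * r" using that polar_gauge_le_iff[OF g] by blast
    finally show ?thesis .
  qed
  have "0 \<le> v_p" "v_p \<le> ereal r1"
    using assms(6) gauge_function_nonneg[OF g] x1 r1 by (auto intro!: INF_greatest INF_lower2)
  then obtain v where v: "v_p = ereal v" "0 \<le> v" by (cases v_p) auto
  have "s1 \<noteq> 0" using weak[OF x1 y1, of r1 s1] r1 s1 by auto
  with s1 have s1_pos: "0 < s1" by simp
  \<comment> \<open>Weak duality against the single feasible point \<open>y1\<close> keeps
    \<open>v_p\<close> away from 0, so that \<open>1 / v\<close> is a genuine reciprocal.\<close>
  have "ereal (1 / s1) \<le> v_p"
    unfolding assms(6)
  proof (rule INF_greatest)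
    fix x assume x: "x \<in> C"
    show "ereal (1 / s1) \<le> \<kappa> x"
    proof (cases "\<kappa> x")
      case (real r)
      then show ?thesis using weak[OF x y1, of r s1] s1 s1_pos by (simp add: field_simps)
    qed (use gauge_function_nonneg[OF g, of x] in auto)
  qed
  then have "1 / s1 \<le> v" using v by simp
  then have v_pos: "0 < v" using s1_pos by (meson less_le_trans zero_less_divide_1_iff)
  \<comment> \<open>Each \<open>y\<close> in the antipolar with finite polar value \<open>s\<close>
    bounds \<open>v_p\<close> below by \<open>1 / s\<close>; here \<open>s\<close> is nonzero by
    weak duality against \<open>x1\<close>.\<close>
  have w_ge: "ereal (1 / v) \<le> v_g"
    unfolding assms(7)
  proof (rule INF_greatest)
    fix y assume y: "y \<in> antipolar C"
    show "ereal (1 / v) \<le> ?\<kappa>' y"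
    proof (cases "?\<kappa>' y")
      case (real s)
      have "s \<noteq> 0" "0 \<le> s"
        using weak[OF x1 y, of r1 s] r1 real gauge_function_nonneg[OF g', of y] by auto
      then have s: "0 < s" by simp
      have "ereal (1 / s) \<le> v_p"
        unfolding assms(6)
      proof (rule INF_greatest)
        fix x assume x: "x \<in> C"
        show "ereal (1 / s) \<le> \<kappa> x"
        proof (cases "\<kappa> x")
          case (real r)
          then show ?thesis
            using weak[OF x y, of r s] \<open>?\<kappa>' y = ereal s\<close> s by (simp add: field_simps)
        qed (use gauge_function_nonneg[OF g, of x] in auto)
      qed
      then show ?thesis using v v_pos s real by (simp add: field_simps)
    qed (use gauge_function_nonneg[OF g', of y] in auto)
  qed
  obtain y where y: "\<And>u r. \<kappa> u \<le> ereal r \<Longrightarrow> u \<bullet> y \<le> r" "\<And>c. c \<in> C \<Longrightarrow> v \<le> c \<bullet> y"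
    using gauge_duality_support[OF g assms(4,9)] assms(6) v by metis
  define y2 where "y2 = (1 / v) *\<^sub>R y"
  have y2: "y2 \<in> antipolar C"
    using y(2) v_pos by (auto simp: y2_def antipolar_def field_simps inner_commute)
  have y2_le: "?\<kappa>' y2 \<le> ereal (1 / v)"
    using y(1) v_pos by (auto simp: y2_def polar_gauge_le_iff[OF g] field_simps)
  have "v_g \<le> ?\<kappa>' y2" unfolding assms(7) using y2 by (rule INF_lower)
  with y2_le w_ge have y2_eq: "?\<kappa>' y2 = v_g" and vg: "v_g = ereal (1 / v)" by (auto intro: antisym order_trans)
  \<comment> \<open>\<open>x(1)\<close> bounds the bipolar at \<open>x\<close> by 1, and
    \<open>x(2)\<close> puts \<open>v *\<^sub>R x\<close> into the double antipolar. So the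
    candidate of value at most \<open>v\<close> is \<open>v *\<^sub>R x\<close> rather than
    \<open>x\<close>.\<close>
  obtain x where x: "\<And>u r. ?\<kappa>' u \<le> ereal r \<Longrightarrow> u \<bullet> x \<le> r" "\<And>c. c \<in> antipolar C \<Longrightarrow> 1 / v \<le> c \<bullet> x"
    using gauge_duality_support[OF g' convex_antipolar assms(10)] assms(7) vg by metis
  have "\<kappa> x \<le> ereal 1"
    using le_one_if_inner_le_polar_gauge[OF g assms(8) x(1)] by (simp flip: one_ereal_def)
  from gauge_function_scaleR_le[OF g v_pos this] have vx_le: "\<kappa> (v *\<^sub>R x) \<le> ereal v" by simp
  have "v *\<^sub>R x \<in> antipolar (antipolar C)"
    using x(2) v_pos by (force simp: antipolar_def field_simps inner_commute)
  then obtain t c where tc: "v *\<^sub>R x = t *\<^sub>R c" "1 \<le> t" "c \<in> C"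
    using antipolar_antipolar_subset[OF assms(4,3,5)] y1 by blast
  have "c = inverse t *\<^sub>R (v *\<^sub>R x)" using tc by simp
  then have "\<kappa> c \<le> ereal (inverse t * v)"
    using gauge_function_scaleR_le[OF g _ vx_le, of "inverse t"] tc(2) by simp
  also have "inverse t * v \<le> v" using tc(2) v_pos by (simp add: field_simps)
  then have "ereal (inverse t * v) \<le> v_p" using v by simp
  finally have "\<kappa> c \<le> v_p" .
  moreover have "v_p \<le> \<kappa> c" unfolding assms(6) using tc(3) by (rule INF_lower)
  ultimately have "\<kappa> c = v_p" by (rule antisym)
  moreover have "v_p * v_g = 1" using v vg v_pos by simp
  ultimately show ?thesis using tc(3) y2 y2_eq by blast
qed

end
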